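(* There exists no pair $(K(s),h)$, with $h\ge0$ a constant time-headway and $K(s)$ a stabilizing linear controller with $K(0)$ finite, which would guarantee $(L_2,\ell_2)$ string stability of the vehicle chain with closed-loop dynamics $$e_1=\frac{1}{s^2+(1+hs)K(s)}\big(d_0-(1+hs)d_1\big),$$ $$e_i=\frac{K(s)}{s^2+(1+hs)K(s)}\,e_{i-1}+\frac{1}{s^2+(1+hs)K(s)}\big(d_{i-1}-(1+hs)d_i\big),\qquad i=2,\dots,N,$$ when $d_0\ne0$, i.e. when disturbances on the leader are admitted. That is, for no such pair is it true that for every $\epsilon>0$ there exists $\delta>0$ such that, for all $N=1,2,\dots$ and all admissible disturbance vectors $d=(d_0,\dots,d_N)$ (with $d_0$ not constrained to be zero), $\Vert d(\cdot)\Vert_2<\delta$ implies $\Vert e(\cdot)\Vert_2<\epsilon$.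
   Context: Vehicle chain: $N+1$ vehicles with positions $x_0(t),\dots,x_N(t)\in\mathbb{R}$ (index $0$ is the leader) obey $\ddot x_i=u_i+d_i$, where $u_i$ is the acceleration control input and $d_i$ the disturbance input; $u_0=0$. With constant time-headway $h\ge0$ and constant $r_0>0$, the spacing errors are $e_i=x_{i-1}-x_i-h\dot x_i-r_0$, $i=1,\dots,N$. The controller is $u_i(s)=K(s)e_i(s)$, $i=1,\dots,N$, with the same linear (time-invariant) transfer function $K(s)$ for all vehicles, which yields the closed-loop equations displayed in the claim, written in the Laplace domain (with zero initial error conditions, so that $e$ is the response to the disturbance $d$). Standing assumption: $K(0)\ne0$ (no pole cancellation). "Stabilizing" means that the closed-loop system is stable, i.e. the closed-loop transfer functions have no poles in the closed right half plane. The pair $(K(s),h)$ does not depend on $N$. Notation: for a scalar signal, $\Vert v(\cdot)\Vert=\sqrt{\int_{-\infty}^{+\infty}|v(t)|^2dt}$. For the vector signals $d=(d_0,\dots,d_N)$ and $e=(e_1,\dots,e_N)$, $\Vert d(\cdot)\Vert_2=\sqrt{\sum_{i=0}^N\Vert d_i(\cdot)\Vert^2}$ and $\Vert e(\cdot)\Vert_2=\sqrt{\sum_{i=1}^N\Vert e_i(\cdot)\Vert^2}$. Definition ($(L_2,\ell_2)$ string stability): with the closed-loop dynamics, for every $\epsilon>0$ there exists $\delta>0$ such that $\Vert d(\cdot)\Vert_2<\delta$ implies $\Vert e(\cdot)\Vert_2<\epsilon$, uniformly for all $N=1,2,\dots$ (the same $\delta$ for all $N$). *)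

theory Defs
  imports "HOL-Complex_Analysis.Complex_Analysis"
begin

text \<open>One-sided Laplace transform and its absolute convergence on \<open>Re s \<ge> \<sigma>\<close>.\<close>

definition laplace :: "(real \<Rightarrow> real) \<Rightarrow> complex \<Rightarrow> complex" where
  "laplace f s = (LINT t:{0..}|lborel. exp (- s * of_real t) * of_real (f t))"

definition laplace_convergent :: "real \<Rightarrow> (real \<Rightarrow> real) \<Rightarrow> bool" where
  "laplace_convergent \<sigma> f \<longleftrightarrow> set_integrable lborel {0..} (\<lambda>t. exp (- \<sigma> * t) * f t)"

definition causal :: "(real \<Rightarrow> real) \<Rightarrow> bool" where
  "causal v \<longleftrightarrow> (\<forall>t<0. v t = 0)"

definition L2_signal :: "(real \<Rightarrow> real) \<Rightarrow> bool" where
  "L2_signal v \<longleftrightarrow> v \<in> borel_measurable lborel \<and> integrable lborel (\<lambda>t. \<bar>v t\<bar>\<^sup>2)"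

text \<open>Only meaningful for square-integrable \<open>v\<close>; otherwise the norm is infinite, but the
  Bochner integral below returns 0. Hence every use is guarded by \<^const>\<open>L2_signal\<close>.\<close>

definition signal_norm :: "(real \<Rightarrow> real) \<Rightarrow> real" where
  "signal_norm v = sqrt (LINT t|lborel. \<bar>v t\<bar>\<^sup>2)"

text \<open>
  Transfer function of a causal linear time-invariant system with real impulse response.
  The impulse response is allowed to be a distribution, namely the \<open>m\<close>-th derivative of a
  function \<open>f\<close> supported on \<open>[0, \<infinity>)\<close>; this is where the factor \<open>s ^ m\<close> comes from.
  Every real rational function is of this form, proper or not (PID laws with pure derivative
  action included), and so are for instance dead times \<open>exp (- \<tau> s)\<close>. Outside the half plane of
  convergence, \<open>F\<close> is the meromorphic continuation, so that one can speak of its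
  poles in the closed right half plane.
\<close>

definition transfer_function :: "(complex \<Rightarrow> complex) \<Rightarrow> bool" where
  "transfer_function F \<longleftrightarrow>
     F meromorphic_on {s. Re s \<ge> 0} \<and>
     (\<exists>\<sigma> m f. laplace_convergent \<sigma> f \<and> (\<forall>s. Re s > \<sigma> \<longrightarrow> F s = s ^ m * laplace f s))"

definition loop_G :: "(complex \<Rightarrow> complex) \<Rightarrow> real \<Rightarrow> complex \<Rightarrow> complex" where
  "loop_G K h s = 1 / (s\<^sup>2 + (1 + of_real h * s) * K s)"

definition loop_T :: "(complex \<Rightarrow> complex) \<Rightarrow> real \<Rightarrow> complex \<Rightarrow> complex" where
  "loop_T K h s = K s / (s\<^sup>2 + (1 + of_real h * s) * K s)"

text \<open>
  The remaining closed-loop transfer function \<open>(1 + h s) * loop_G K h s\<close> is a polynomial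
  multiple of \<open>loop_G K h\<close> and needs no separate condition. For a real rational \<open>K\<close> with
  \<open>s\<^sup>2 + (1 + h s) K s\<close> not identically zero, the two conditions
  \<^const>\<open>transfer_function\<close> hold automatically.
\<close>

definition stabilizing :: "(complex \<Rightarrow> complex) \<Rightarrow> real \<Rightarrow> bool" where
  "stabilizing K h \<longleftrightarrow>
     transfer_function (loop_G K h) \<and> transfer_function (loop_T K h) \<and>
     (\<forall>s. Re s \<ge> 0 \<longrightarrow> \<not> is_pole (loop_G K h) s \<and> \<not> is_pole (loop_T K h) s)"

text \<open>
  \<open>e 1, \<dots>, e N\<close> is the response to \<open>d 0, \<dots>, d N\<close>; the values of \<open>d\<close> and \<open>e\<close> at other indices
  are irrelevant. The equations are those between Laplace transforms, on a common half plane
  of convergence.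
\<close>

definition closed_loop ::
  "(complex \<Rightarrow> complex) \<Rightarrow> real \<Rightarrow> nat \<Rightarrow> (nat \<Rightarrow> real \<Rightarrow> real) \<Rightarrow> (nat \<Rightarrow> real \<Rightarrow> real) \<Rightarrow> bool" where
  "closed_loop K h N d e \<longleftrightarrow>
     (\<forall>i\<in>{0..N}. causal (d i)) \<and> (\<forall>i\<in>{1..N}. causal (e i)) \<and>
     (\<exists>\<sigma>. (\<forall>i\<in>{0..N}. laplace_convergent \<sigma> (d i)) \<and>
          (\<forall>i\<in>{1..N}. laplace_convergent \<sigma> (e i)) \<and>
          (\<forall>s. Re s > \<sigma> \<longrightarrow>
             laplace (e 1) s =
               loop_G K h s * (laplace (d 0) s - (1 + of_real h * s) * laplace (d 1) s) \<and>
             (\<forall>i\<in>{2..N}. laplace (e i) s =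
               loop_T K h s * laplace (e (i - 1)) s +
               loop_G K h s * (laplace (d (i - 1)) s - (1 + of_real h * s) * laplace (d i) s))))"

text \<open>An \<open>e\<close> with a component that is not square-integrable has infinite norm, so the bound
  on its norm includes square-integrability.\<close>

definition L2_l2_string_stable :: "(complex \<Rightarrow> complex) \<Rightarrow> real \<Rightarrow> bool" where
  "L2_l2_string_stable K h \<longleftrightarrow>
     (\<forall>\<epsilon>>0. \<exists>\<delta>>0. \<forall>N\<ge>1. \<forall>d e.
        (\<forall>i\<in>{0..N}. L2_signal (d i)) \<longrightarrow> closed_loop K h N d e \<longrightarrow>
        L2_set (\<lambda>i. signal_norm (d i)) {0..N} < \<delta> \<longrightarrow>
        (\<forall>i\<in>{1..N}. L2_signal (e i)) \<and> L2_set (\<lambda>i. signal_norm (e i)) {1..N} < \<epsilon>)"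

end

theory Submission
  imports Defs "HOL-Real_Asymp.Real_Asymp"
begin

text \<open>
  At zero frequency the chain has no attenuation: since \<open>K 0 \<noteq> 0\<close>, one has
  \<open>T 0 = K 0 / K 0 = 1\<close> and \<open>G 0 = 1 / K 0 \<noteq> 0\<close> for the two loop transfer functions \<open>T\<close> and \<open>G\<close>.
  If only the leader is disturbed, then \<open>e\<^sub>i = T\<^bsup>i-1\<^esup> G d\<^sub>0\<close>, and for a slow disturbance all \<open>N\<close> errors
  are about as large as \<open>G 0 d\<^sub>0\<close>. Hence \<open>\<parallel>e\<parallel>\<^sub>2\<close> is about \<open>\<surd>N \<bar>G 0\<bar> \<parallel>d\<^sub>0\<parallel>\<close>, and no \<open>\<delta>\<close> works
  for all \<open>N\<close>.

  The size of \<open>e\<^sub>i\<close> is read off from its Laplace transform at one small real point \<open>a > 0\<close>. For a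
  causal square-integrable \<open>e\<close> with Laplace transform \<open>E\<close>, the inequality of Cauchy and Schwarz against \<open>exp (- a t)\<close> gives \<open>2 a \<bar>E a\<bar>\<^sup>2 \<le> \<parallel>e\<parallel>\<^sup>2\<close>
  (\<open>laplace_le_signal_norm\<close>), with equality for \<open>exp (- a t)\<close> itself. With \<open>d\<^sub>0\<close> proportional to
  \<open>exp (- a t)\<close> this says \<open>\<parallel>e\<^sub>i\<parallel> \<ge> \<bar>T a\<bar>\<^bsup>i-1\<^esup> \<bar>G a\<bar> \<parallel>d\<^sub>0\<parallel>\<close>, and the right-hand side tends to
  \<open>\<bar>G 0\<bar> \<parallel>d\<^sub>0\<parallel>\<close> as \<open>a \<rightarrow> 0\<close>.

  Two points need care. First, the impulse responses may be distributions, that is, \<open>T\<close> and \<open>G\<close> may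
  contain factors \<open>s\<^sup>m\<close>, whereas \<open>e\<^sub>i\<close> must be a function. So \<open>exp (- a t)\<close> is passed through enough
  low-pass filters \<open>1 / (s + 1)\<close>. The cut-off frequency of the filters is \<open>1\<close>, so that for \<open>a \<rightarrow> 0\<close> with \<open>N\<close> fixed they
  change neither the norm of the disturbance nor its Laplace transform at \<open>a\<close> in the limit
  (\<open>smoothed_exp_decay\<close>, \<open>chain_response_exists\<close>). Secondly, the loop equations relate Laplace transforms on some
  half plane \<open>Re s > \<sigma>\<close> only. Square-integrability of \<open>e\<^sub>i\<close>, which string stability provides, makes its
  Laplace transform analytic on \<open>Re s > 0\<close>, and the identity theorem for meromorphic functions carries
  the equation over to \<open>a\<close> (\<open>realized_laplace_eq\<close>).
\<close>

section \<open>Laplace transforms of causal signals\<close>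

lemma laplace_causal:
  assumes "causal f"
  shows "laplace f s = (LINT t|lborel. exp (- s * of_real t) * of_real (f t))"
  unfolding laplace_def set_lebesgue_integral_def
  using assms by (intro Bochner_Integration.integral_cong) (auto simp: causal_def indicator_def not_le)

lemma laplace_convergent_causal:
  assumes "causal f"
  shows "laplace_convergent \<sigma> f \<longleftrightarrow> integrable lborel (\<lambda>t. exp (- \<sigma> * t) * f t)"
  unfolding laplace_convergent_def set_integrable_def
  using assms by (intro Bochner_Integration.integrable_cong) (auto simp: causal_def indicator_def not_le)

lemma laplace_convergent_imp_measurable:
  assumes "causal f" "laplace_convergent \<sigma> f"
  shows "f \<in> borel_measurable borel"
proof -
  have "(\<lambda>t. exp (- \<sigma> * t) * f t) \<in> borel_measurable borel"
    using assms laplace_convergent_causal borel_measurable_integrable by force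
  then have "(\<lambda>t. exp (\<sigma> * t) * (exp (- \<sigma> * t) * f t)) \<in> borel_measurable borel"
    by measurable
  then show ?thesis
    by (simp add: mult.assoc[symmetric] exp_add[symmetric])
qed

lemma laplace_integrable:
  assumes "causal f" "laplace_convergent \<sigma> f" "Re s \<ge> \<sigma>"
  shows "integrable lborel (\<lambda>t. exp (- s * of_real t) * of_real (f t) :: complex)"
proof (rule Bochner_Integration.integrable_bound)
  show "integrable lborel (\<lambda>t. exp (- \<sigma> * t) * f t)"
    using assms laplace_convergent_causal by blast
  have [measurable]: "f \<in> borel_measurable borel"
    using assms laplace_convergent_imp_measurable by blast
  show "(\<lambda>t. exp (- s * of_real t) * of_real (f t) :: complex) \<in> borel_measurable lborel"
    by measurable
  show "AE t in lborel. norm (exp (- s * of_real t) * of_real (f t) :: complex)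
          \<le> norm (exp (- \<sigma> * t) * f t)"
  proof (rule AE_I2)
    fix t :: real
    show "norm (exp (- s * of_real t) * of_real (f t) :: complex) \<le> norm (exp (- \<sigma> * t) * f t)"
    proof (cases "t < 0")
      case True
      then show ?thesis using assms by (simp add: causal_def)
    next
      case False
      then have "exp (- Re s * t) \<le> exp (- \<sigma> * t)"
        using assms by (simp add: mult_right_mono)
      then show ?thesis
        by (simp add: norm_mult abs_mult mult_right_mono)
    qed
  qed
qed

lemma laplace_convergent_mono:
  assumes "causal f" "laplace_convergent \<sigma> f" "\<sigma> \<le> \<tau>"
  shows "laplace_convergent \<tau> f"
proof -
  have "integrable lborel (\<lambda>t. exp (- of_real \<tau> * of_real t) * of_real (f t) :: complex)"
    by (rule laplace_integrable[OF assms(1,2)]) (use assms in simp)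
  then have "integrable lborel (\<lambda>t. complex_of_real (exp (- \<tau> * t) * f t))"
    by (simp add: exp_of_real[symmetric])
  then show ?thesis
    using assms(1) by (simp only: laplace_convergent_causal complex_of_real_integrable_eq)
qed

text \<open>
  The abscissa \<open>\<sigma>\<close> is a fixed parameter, instead of being quantified existentially in the definition,
  because the chain equations ask for one half plane that serves all signals at once.
\<close>

definition realizes :: "real \<Rightarrow> (real \<Rightarrow> real) \<Rightarrow> (complex \<Rightarrow> complex) \<Rightarrow> bool" where
  "realizes \<sigma> f F \<longleftrightarrow> causal f \<and> laplace_convergent \<sigma> f \<and> (\<forall>s. Re s > \<sigma> \<longrightarrow> laplace f s = F s)"

lemma realizes_cong:
  assumes "realizes \<sigma> f F" "\<And>s. Re s > \<sigma> \<Longrightarrow> F s = G s"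
  shows "realizes \<sigma> f G"
  using assms by (simp add: realizes_def)

lemma realizes_diff:
  assumes "realizes \<sigma> f F" "realizes \<sigma> g G"
  shows "realizes \<sigma> (\<lambda>t. f t - g t) (\<lambda>s. F s - G s)"
proof -
  have c: "causal f" "causal g" "causal (\<lambda>t. f t - g t)"
    and L: "laplace_convergent \<sigma> f" "laplace_convergent \<sigma> g"
    using assms by (auto simp: realizes_def causal_def)
  have "laplace_convergent \<sigma> (\<lambda>t. f t - g t)"
    using L unfolding laplace_convergent_causal[OF c(1)] laplace_convergent_causal[OF c(2)]
      laplace_convergent_causal[OF c(3)] by (simp add: right_diff_distrib)
  moreover have "laplace (\<lambda>t. f t - g t) s = F s - G s" if s: "Re s > \<sigma>" for s
  proof -
    have "laplace (\<lambda>t. f t - g t) s = laplace f s - laplace g s"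
      unfolding laplace_causal[OF c(1)] laplace_causal[OF c(2)] laplace_causal[OF c(3)]
      using laplace_integrable[OF c(1) L(1), of s] laplace_integrable[OF c(2) L(2), of s] s
      by (simp add: right_diff_distrib)
    then show ?thesis using assms s by (simp add: realizes_def)
  qed
  ultimately show ?thesis using c by (simp add: realizes_def)
qed

lemma realizes_scale:
  assumes "realizes \<sigma> f F"
  shows "realizes \<sigma> (\<lambda>t. c * f t) (\<lambda>s. of_real c * F s)"
proof -
  have c: "causal f" "causal (\<lambda>t. c * f t)"
    and L: "laplace_convergent \<sigma> f"
    using assms by (auto simp: realizes_def causal_def)
  have "laplace_convergent \<sigma> (\<lambda>t. c * f t)"
    using integrable_mult_right[OF L[unfolded laplace_convergent_causal[OF c(1)]], of c]
    unfolding laplace_convergent_causal[OF c(2)] by (simp add: mult_ac)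
  moreover have "laplace (\<lambda>t. c * f t) s = of_real c * F s" if s: "Re s > \<sigma>" for s
  proof -
    have "laplace (\<lambda>t. c * f t) s = of_real c * laplace f s"
      unfolding laplace_causal[OF c(1)] laplace_causal[OF c(2)]
      by (subst integral_mult_right_zero[symmetric]) (simp add: mult_ac)
    then show ?thesis using assms s by (simp add: realizes_def)
  qed
  ultimately show ?thesis using c by (simp add: realizes_def)
qed

lemma realizes_zero: "realizes \<sigma> (\<lambda>t. 0) (\<lambda>s. 0)"
  by (simp add: realizes_def causal_def laplace_convergent_def laplace_def set_integrable_def
      set_lebesgue_integral_def)

section \<open>Convolution\<close>

definition conv :: "(real \<Rightarrow> real) \<Rightarrow> (real \<Rightarrow> real) \<Rightarrow> real \<Rightarrow> real" where
  "conv f g t = (LINT u|lborel. f (t - u) * g u)"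

lemma integral_reflect_shift:
  fixes f :: "real \<Rightarrow> 'a :: {banach, second_countable_topology}"
  shows "(LINT u|lborel. f (t - u)) = (LINT u|lborel. f u)"
  using lborel_integral_real_affine[of "-1" f t] by simp

lemma integral_shift:
  fixes f :: "real \<Rightarrow> 'a :: {banach, second_countable_topology}"
  shows "(LINT t|lborel. f (t - u)) = (LINT t|lborel. f t)"
  using lborel_integral_real_affine[of 1 f "-u"] by simp

lemma integrable_shift:
  fixes f :: "real \<Rightarrow> 'a :: {banach, second_countable_topology}"
  shows "integrable lborel (\<lambda>t. f (t - u)) \<longleftrightarrow> integrable lborel f"
  using lborel_integrable_real_affine_iff[of 1 f "-u"] by simp

text \<open>
  Fubini's theorem applies since \<open>\<bar>F (t - u)\<bar> \<bar>G u\<bar>\<close> has the integral \<open>\<parallel>F\<parallel>\<^sub>1 \<parallel>G\<parallel>\<^sub>1\<close>.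
\<close>

lemma
  fixes F G :: "real \<Rightarrow> 'a :: {banach, real_normed_field, second_countable_topology}"
  assumes F: "integrable lborel F" and G: "integrable lborel G"
  shows integrable_convolution: "integrable lborel (\<lambda>t. LINT u|lborel. F (t - u) * G u)"
    and integral_convolution:
      "(LINT t|lborel. LINT u|lborel. F (t - u) * G u) = (LINT t|lborel. F t) * (LINT t|lborel. G t)"
proof -
  have [measurable]: "F \<in> borel_measurable borel" "G \<in> borel_measurable borel"
    using borel_measurable_integrable[OF F] borel_measurable_integrable[OF G] by auto
  have joint: "integrable (lborel \<Otimes>\<^sub>M lborel) (\<lambda>(u, t). F (t - u) * G u)"
  proof (rule lborel_pair.Fubini_integrable)
    show "(\<lambda>(u, t). F (t - u) * G u) \<in> borel_measurable (lborel \<Otimes>\<^sub>M lborel)"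
      by measurable
    show "integrable lborel
        (\<lambda>u. LINT t|lborel. norm (case (u, t) of (u, t) \<Rightarrow> F (t - u) * G u))"
      using G by (simp add: norm_mult integral_shift[of "\<lambda>t. norm (F t)"])
    show "AE u in lborel. integrable lborel (\<lambda>t. case (u, t) of (u, t) \<Rightarrow> F (t - u) * G u)"
      using F by (simp add: integrable_shift[of F])
  qed
  show "integrable lborel (\<lambda>t. LINT u|lborel. F (t - u) * G u)"
    using lborel_pair.integrable_snd[OF joint] .
  show "(LINT t|lborel. LINT u|lborel. F (t - u) * G u) = (LINT t|lborel. F t) * (LINT t|lborel. G t)"
    using lborel_pair.Fubini_integral[OF joint] by (simp add: integral_shift[of F])
qed

lemma causal_conv:
  assumes "causal f" "causal g"
  shows "causal (conv f g)"
  unfolding causal_def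
proof (intro allI impI)
  fix t :: real assume t: "t < 0"
  have "f (t - u) * g u = 0" for u
    using assms t by (cases "u < 0") (auto simp: causal_def)
  then show "conv f g t = 0"
    unfolding conv_def by (simp only: integral_zero)
qed

text \<open>
  Exponential weights commute with convolution, because \<open>exp (- s t) = exp (- s (t - u)) exp (- s u)\<close>.
  This reduces the Laplace transform of a convolution to the integral of a convolution. Where the
  convolution integral diverges, both sides have the default value \<open>0\<close>.
\<close>

lemma conv_exp_weight:
  "exp (- s * of_real t) * of_real (conv f g t) =
    (LINT u|lborel. (exp (- s * of_real (t - u)) * of_real (f (t - u))) *
       (exp (- s * of_real u) * of_real (g u)) :: complex)"
proof -
  have e: "exp (- s * of_real (t - u)) * exp (- s * of_real u) = exp (- s * of_real t)" for u
    by (simp add: exp_add[symmetric] algebra_simps)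
  have *: "(exp (- s * of_real (t - u)) * a) * (exp (- s * of_real u) * b) =
      exp (- s * of_real t) * (a * b)" for u a b
    unfolding e[symmetric, of u] by (simp only: mult_ac)
  have "(LINT u|lborel. (exp (- s * of_real (t - u)) * of_real (f (t - u))) *
       (exp (- s * of_real u) * of_real (g u)) :: complex) =
    (LINT u|lborel. exp (- s * of_real t) * of_real (f (t - u) * g u))"
    by (intro Bochner_Integration.integral_cong refl) (simp only: * of_real_mult)
  then show ?thesis
    by (simp only: integral_mult_right_zero integral_complex_of_real conv_def)
qed

lemma realizes_mult:
  assumes "realizes \<sigma> f F" "realizes \<sigma> g G"
  shows "realizes \<sigma> (conv f g) (\<lambda>s. F s * G s)"
proof -
  have c: "causal f" "causal g" "causal (conv f g)"
    and L: "laplace_convergent \<sigma> f" "laplace_convergent \<sigma> g"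
    using assms causal_conv by (auto simp: realizes_def)
  note I = laplace_integrable[OF c(1) L(1)] laplace_integrable[OF c(2) L(2)]
  have "integrable lborel
      (\<lambda>t. exp (- of_real \<sigma> * of_real t) * of_real (conv f g t) :: complex)"
    unfolding conv_exp_weight using I[of "of_real \<sigma>"] by (intro integrable_convolution) auto
  then have "integrable lborel (\<lambda>t. complex_of_real (exp (- \<sigma> * t) * conv f g t))"
    by (simp add: exp_of_real[symmetric])
  then have "laplace_convergent \<sigma> (conv f g)"
    by (simp only: laplace_convergent_causal[OF c(3)] complex_of_real_integrable_eq)
  moreover have "laplace (conv f g) s = F s * G s" if s: "Re s > \<sigma>" for s
  proof -
    have "laplace (conv f g) s = laplace f s * laplace g s"
      unfolding laplace_causal[OF c(1)] laplace_causal[OF c(2)] laplace_causal[OF c(3)]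
        conv_exp_weight
      using I[of s] s by (intro integral_convolution) auto
    then show ?thesis using assms s by (simp add: realizes_def)
  qed
  ultimately show ?thesis using c by (simp add: realizes_def)
qed

lemma realizes_power_mult:
  assumes "realizes \<sigma> f F" "realizes \<sigma> g G"
  shows "\<exists>k. realizes \<sigma> k (\<lambda>s. F s ^ n * G s)"
proof (induction n)
  case 0
  then show ?case using assms(2) by auto
next
  case (Suc n)
  then obtain k where "realizes \<sigma> k (\<lambda>s. F s ^ n * G s)" by blast
  from realizes_mult[OF assms(1) this] show ?case
    by (auto simp: mult.assoc)
qed

section \<open>Decaying exponentials\<close>

definition exp_decay :: "real \<Rightarrow> real \<Rightarrow> real" where
  "exp_decay b t = (if t < 0 then 0 else exp (- b * t))"

lemma
  assumes "b > 0"
  shows integrable_exp_decay: "integrable lborel (exp_decay b)"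
    and integral_exp_decay: "(LINT t|lborel. exp_decay b t) = 1 / b"
proof -
  have nn: "(\<integral>\<^sup>+t. ennreal (exp_decay b t) \<partial>lborel) = ennreal (1 / b)"
  proof -
    have lim: "((\<lambda>t. - exp (- b * t) / b) \<longlongrightarrow> 0) at_top"
      using assms by real_asymp
    have "(\<integral>\<^sup>+t. ennreal (exp_decay b t) \<partial>lborel) =
        (\<integral>\<^sup>+t. ennreal (exp (- b * t)) * indicator {0..} t \<partial>lborel)"
      by (intro nn_integral_cong) (auto simp: exp_decay_def indicator_def)
    also have "\<dots> = ennreal (0 - (- exp (- b * 0) / b))"
      using lim assms
      by (intro nn_integral_FTC_atLeast) (auto intro!: derivative_eq_intros simp: field_simps)
    finally show ?thesis by simp
  qed
  have m: "exp_decay b \<in> borel_measurable lborel"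
    unfolding exp_decay_def[abs_def] by measurable
  show "integrable lborel (exp_decay b)"
    using m nn by (intro integrableI_nonneg) (auto simp: exp_decay_def)
  show "(LINT t|lborel. exp_decay b t) = 1 / b"
    using m nn assms by (subst integral_eq_nn_integral) (auto simp: exp_decay_def)
qed

lemma tendsto_exp_decay_0:
  fixes b :: real
  assumes "b > 0"
  shows "((\<lambda>t. exp (- b * t)) \<longlongrightarrow> 0) at_top"
  using assms by real_asymp

lemma causal_exp_decay: "causal (exp_decay b)"
  by (simp add: causal_def exp_decay_def)

lemma exp_decay_mult: "exp (- c * t) * exp_decay b t = exp_decay (c + b) t"
  by (auto simp: exp_decay_def exp_add[symmetric] algebra_simps)

lemma realizes_exp_decay:
  assumes "\<sigma> + b > 0"
  shows "realizes \<sigma> (exp_decay b) (\<lambda>s. 1 / (s + of_real b))"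
proof -
  have L: "laplace_convergent \<sigma> (exp_decay b)"
    unfolding laplace_convergent_causal[OF causal_exp_decay] exp_decay_mult
    using assms by (rule integrable_exp_decay)
  moreover have "laplace (exp_decay b) s = 1 / (s + of_real b)" if s: "Re s > \<sigma>" for s
  proof -
    define c where "c = s + of_real b"
    have c: "Re c > 0" "c \<noteq> 0"
      using s assms by (auto simp: c_def complex_eq_iff)
    have ec: "exp (- s * of_real t) * of_real (exp_decay b t) = exp (- c * of_real t)" if "t \<ge> 0" for t
      using that unfolding c_def exp_decay_def exp_of_real[symmetric]
      by (simp add: exp_add[symmetric] exp_of_real[symmetric] algebra_simps)
    have "laplace (exp_decay b) s = (LINT t:{0<..}|lborel. exp (- c * of_real t))"
      unfolding laplace_causal[OF causal_exp_decay] set_lebesgue_integral_def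
    proof (rule integral_cong_AE)
      show "(\<lambda>t. exp (- s * of_real t) * of_real (exp_decay b t) :: complex) \<in> borel_measurable lborel"
        using borel_measurable_integrable[OF laplace_integrable[OF causal_exp_decay L, of s]] s by auto
      show "AE t in lborel. exp (- s * of_real t) * of_real (exp_decay b t) =
              indicator {0<..} t *\<^sub>R exp (- c * of_real t)"
        using AE_lborel_singleton[of 0]
      proof eventually_elim
        case (elim t)
        show ?case
        proof (cases "t < 0")
          case False
          then show ?thesis using ec[of t] elim by auto
        qed (auto simp: exp_decay_def)
      qed
    qed measurable
    also have "\<dots> = (LBINT t=0..\<infinity>. exp (- c * of_real t))"
      by (simp add: interval_lebesgue_integral_0_infty)
    also have "\<dots> = 0 - (- 1 / c)"
    proof (rule interval_integral_FTC_integrable)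
      show "((\<lambda>t. - exp (- c * of_real t) / c) has_vector_derivative exp (- c * of_real x)) (at x)" for x
        using c by (auto intro!: derivative_eq_intros has_vector_derivative_real_field)
      show "set_integrable lborel (einterval 0 \<infinity>) (\<lambda>t. exp (- c * of_real t))"
      proof -
        have "integrable lborel (\<lambda>t. indicator {0<..} t *\<^sub>R
            (exp (- s * of_real t) * of_real (exp_decay b t) :: complex))"
          using laplace_integrable[OF causal_exp_decay L, of s] s
          by (intro integrable_mult_indicator) auto
        also have "(\<lambda>t. indicator {0<..} t *\<^sub>R
            (exp (- s * of_real t) * of_real (exp_decay b t) :: complex)) =
            (\<lambda>t. indicator {0<..} t *\<^sub>R exp (- c * of_real t))"
          using ec by (auto simp: indicator_def fun_eq_iff)
        finally show ?thesis
          by (simp add: set_integrable_def zero_ereal_def)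
      qed
      have "((\<lambda>t. - exp (- c * of_real t) / c) \<longlongrightarrow> - exp (- c * of_real 0) / c) (at_right 0)"
        by (intro tendsto_intros) (use c in auto)
      then show "(((\<lambda>t. - exp (- c * of_real t) / c) \<circ> real_of_ereal) \<longlongrightarrow> - 1 / c) (at_right 0)"
        by (simp add: zero_ereal_def ereal_tendsto_simps)
      have "((\<lambda>t. exp (- Re c * t)) \<longlongrightarrow> 0) at_top"
        using tendsto_exp_decay_0[OF c(1)] .
      then have "((\<lambda>t. exp (- c * complex_of_real t)) \<longlongrightarrow> 0) at_top"
        by (rule_tac tendsto_norm_zero_cancel) simp
      then have "((\<lambda>t. - exp (- c * of_real t) / c) \<longlongrightarrow> - 0 / c) at_top"
        by (rule tendsto_divide[OF tendsto_minus tendsto_const c(2)])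
      then show "(((\<lambda>t. - exp (- c * of_real t) / c) \<circ> real_of_ereal) \<longlongrightarrow> 0) (at_left \<infinity>)"
        by (simp add: ereal_tendsto_simps)
    qed (auto intro!: continuous_intros)
    finally show ?thesis by (simp add: c_def)
  qed
  ultimately show ?thesis using causal_exp_decay by (simp add: realizes_def)
qed

section \<open>Analyticity of the Laplace transform\<close>

lemma exp_partial_sum_le:
  assumes "(y::real) \<ge> 0"
  shows "(\<Sum>k<n. y ^ k / fact k) \<le> exp y"
proof -
  have s: "(\<lambda>k. y ^ k / fact k) sums exp y"
    using exp_converges[of y] by (simp add: divide_inverse mult.commute)
  then have "(\<Sum>k<n. y ^ k / fact k) \<le> (\<Sum>k. y ^ k / fact k)"
    using assms by (intro sum_le_suminf) (auto simp: sums_iff)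
  then show ?thesis
    using s by (simp add: sums_iff)
qed

text \<open>
  The factor \<open>exp (- (s - s0) t)\<close> is expanded in powers of \<open>s - s0\<close> under the integral. All partial sums
  are dominated by \<open>exp (- x t) \<bar>f t\<bar>\<close> with \<open>x = Re s0 - \<bar>s - s0\<bar>\<close>, which is integrable as long as
  \<open>x > \<sigma>\<close>. So the expansion about \<open>s0\<close> is valid in the largest disc inside the half plane of
  convergence.
\<close>

lemma laplace_power_series:
  assumes c: "causal f" and L: "\<And>x. x > \<sigma> \<Longrightarrow> laplace_convergent x f"
    and s0: "norm (s - s0) < Re s0 - \<sigma>"
  shows "(\<lambda>k. (LINT t|lborel. (- of_real t) ^ k / fact k * (exp (- s0 * of_real t) * of_real (f t))) *
           (s - s0) ^ k) sums laplace f s"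
proof -
  define w where "w = s - s0"
  define x where "x = Re s0 - norm w"
  have x: "x > \<sigma>" "Re s0 > \<sigma>"
    using s0 norm_ge_zero[of w] unfolding x_def w_def by linarith+
  define B where "B = (\<lambda>t. norm (exp (- x * t) * f t))"
  define \<phi> where "\<phi> = (\<lambda>k t. (- of_real t) ^ k / fact k * (exp (- s0 * of_real t) * of_real (f t)) * w ^ k)"
  have f[measurable]: "f \<in> borel_measurable borel"
    using laplace_convergent_imp_measurable[OF c L[OF x(1)]] .
  have B: "integrable lborel B"
    using L[OF x(1)] unfolding B_def laplace_convergent_causal[OF c] by (rule integrable_norm)
  have partial: "(\<Sum>k<n. norm (\<phi> k t)) \<le> B t" for n t
  proof (cases "t < 0")
    case True
    then show ?thesis using c by (simp add: \<phi>_def B_def causal_def)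
  next
    case False
    have "(\<Sum>k<n. norm (\<phi> k t)) = (\<Sum>k<n. (norm w * t) ^ k / fact k) * (exp (- Re s0 * t) * \<bar>f t\<bar>)"
      using False unfolding sum_distrib_right \<phi>_def
      by (intro sum.cong refl) (simp add: norm_mult norm_divide norm_power power_mult_distrib)
    also have "\<dots> \<le> exp (norm w * t) * (exp (- Re s0 * t) * \<bar>f t\<bar>)"
      using False by (intro mult_right_mono exp_partial_sum_le) auto
    also have "exp (norm w * t) * (exp (- Re s0 * t) * \<bar>f t\<bar>) =
        exp (norm w * t + - Re s0 * t) * \<bar>f t\<bar>"
      by (simp only: exp_add mult.assoc)
    also have "norm w * t + - Re s0 * t = - x * t"
      by (simp add: x_def algebra_simps)
    also have "exp (- x * t) * \<bar>f t\<bar> = B t"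
      by (simp add: B_def abs_mult)
    finally show ?thesis .
  qed
  have single: "norm (\<phi> k t) \<le> B t" for k t
  proof -
    have "norm (\<phi> k t) \<le> (\<Sum>j<Suc k. norm (\<phi> j t))"
      by (rule member_le_sum) auto
    then show ?thesis using partial[of t "Suc k"] by linarith
  qed
  have int: "integrable lborel (\<phi> k)" for k
    by (rule Bochner_Integration.integrable_bound[OF B])
       (use single in \<open>auto simp: \<phi>_def B_def\<close>)
  have "(\<lambda>k. integral\<^sup>L lborel (\<phi> k)) sums (LINT t|lborel. (\<Sum>k. \<phi> k t))"
  proof (rule sums_integral[OF int])
    show "AE t in lborel. summable (\<lambda>k. norm (\<phi> k t))"
      using partial[of _ "Suc _"]
      by (intro AE_I2 bounded_imp_summable) (auto simp only: lessThan_Suc_atMost norm_ge_zero)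
    show "summable (\<lambda>k. LINT t|lborel. norm (\<phi> k t))"
    proof (rule bounded_imp_summable)
      fix n
      have "(\<Sum>k\<le>n. LINT t|lborel. norm (\<phi> k t)) = (LINT t|lborel. (\<Sum>k<Suc n. norm (\<phi> k t)))"
        using int by (simp add: lessThan_Suc_atMost)
      also have "\<dots> \<le> integral\<^sup>L lborel B"
        using partial[of _ "Suc n"] int B by (intro integral_mono) auto
      finally show "(\<Sum>k\<le>n. LINT t|lborel. norm (\<phi> k t)) \<le> integral\<^sup>L lborel B" .
    qed auto
  qed
  also have "(LINT t|lborel. (\<Sum>k. \<phi> k t)) = laplace f s"
    unfolding laplace_causal[OF c]
  proof (intro Bochner_Integration.integral_cong refl)
    fix t
    have "(\<lambda>k. (- (w * of_real t)) ^ k / fact k) sums exp (- (w * of_real t))"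
      using exp_converges[of "- (w * of_real t)"]
      by (simp add: scaleR_conv_of_real divide_inverse mult.commute)
    then have "(\<lambda>k. (- (w * of_real t)) ^ k / fact k * (exp (- s0 * of_real t) * of_real (f t)))
        sums (exp (- (w * of_real t)) * (exp (- s0 * of_real t) * of_real (f t)))"
      by (rule sums_mult2)
    moreover have "(- (w * of_real t)) ^ k / fact k * (exp (- s0 * of_real t) * of_real (f t)) = \<phi> k t" for k
      unfolding \<phi>_def mult_minus_right[symmetric] power_mult_distrib by simp
    moreover have "exp (- (w * of_real t)) * (exp (- s0 * of_real t) * of_real (f t)) =
        exp (- s * of_real t) * of_real (f t)"
    proof -
      have "- s * of_real t = - (w * of_real t) + - s0 * of_real t"
        by (simp add: w_def algebra_simps)
      then show ?thesis
        by (simp only: exp_add mult.assoc)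
    qed
    ultimately show "(\<Sum>k. \<phi> k t) = exp (- s * of_real t) * of_real (f t)"
      by (simp add: sums_iff)
  qed
  finally show ?thesis
    by (simp add: \<phi>_def w_def)
qed

lemma laplace_holomorphic:
  assumes c: "causal f" and L: "\<And>x. x > \<sigma> \<Longrightarrow> laplace_convergent x f"
  shows "laplace f holomorphic_on {s. Re s > \<sigma>}"
proof -
  have A: "laplace f analytic_on ball s0 (Re s0 - \<sigma>)" for s0
    by (rule power_series_analytic, rule laplace_power_series[OF c L])
       (auto simp: dist_norm norm_minus_commute)
  have "laplace f analytic_on {s0}" if "Re s0 > \<sigma>" for s0
    using analytic_on_subset[OF A[of s0]] that by auto
  then show ?thesis
    by (intro analytic_imp_holomorphic) (auto simp: analytic_on_def)
qed

text \<open>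
  Meromorphic functions on a connected open set that agree on an open piece of it agree outside a sparse
  set. Their values at singularities are arbitrary, hence the conclusion is restricted to points at which
  both functions are analytic.
\<close>

lemma meromorphic_identity:
  assumes mero: "f meromorphic_on A" "g meromorphic_on A" and A: "open A" "connected A"
    and U: "open U" "u \<in> U" "U \<subseteq> A" "\<And>s. s \<in> U \<Longrightarrow> f s = g s"
    and z: "z \<in> A" "f analytic_on {z}" "g analytic_on {z}"
  shows "f z = g z"
proof -
  define D where "D s = f s - g s" for s
  have D: "D meromorphic_on A" and Dz: "D analytic_on {z}"
    unfolding D_def[abs_def] using mero z by (auto intro!: meromorphic_intros analytic_intros)
  have "eventually (\<lambda>s. s \<in> U) (at u)"
    using U by (intro eventually_at_in_open') auto
  then have D0: "eventually (\<lambda>s. D s = 0) (at u)"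
    by eventually_elim (simp add: D_def U)
  have "\<not> eventually (\<lambda>s. D s \<noteq> 0) (cosparse A)"
  proof
    assume "eventually (\<lambda>s. D s \<noteq> 0) (cosparse A)"
    then have "eventually (\<lambda>s. D s \<noteq> 0) (at u)"
      using A U by (auto simp: eventually_cosparse_open_eq)
    with D0 have "eventually (\<lambda>_. False) (at u)"
      by eventually_elim auto
    then show False by simp
  qed
  then have "eventually (\<lambda>s. D s = 0) (cosparse A)"
    using meromorphic_imp_constant_or_avoid[OF D A] by blast
  then have "eventually (\<lambda>s. D s = 0) (at z)"
    using A z by (auto simp: eventually_cosparse_open_eq)
  then have "D \<midarrow>z\<rightarrow> 0"
    by (rule tendsto_eventually)
  moreover have "D \<midarrow>z\<rightarrow> D z"
    using Dz by (simp add: analytic_at_imp_isCont isContD)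
  ultimately have "D z = 0"
    using tendsto_unique trivial_limit_at by blast
  then show ?thesis by (simp add: D_def)
qed

section \<open>Square-integrable signals\<close>

lemma L2_imp_laplace_convergent:
  assumes c: "causal e" and e: "L2_signal e" and x: "x > 0"
  shows "laplace_convergent x e"
  unfolding laplace_convergent_causal[OF c]
proof (rule Bochner_Integration.integrable_bound)
  have [measurable]: "e \<in> borel_measurable borel"
    using e by (simp add: L2_signal_def)
  show "integrable lborel (\<lambda>t. exp_decay (2 * x) t + \<bar>e t\<bar>\<^sup>2)"
    using e integrable_exp_decay[of "2 * x"] x by (simp add: L2_signal_def)
  show "(\<lambda>t. exp (- x * t) * e t) \<in> borel_measurable lborel"
    by measurable
  show "AE t in lborel. norm (exp (- x * t) * e t) \<le> norm (exp_decay (2 * x) t + \<bar>e t\<bar>\<^sup>2)"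
  proof (rule AE_I2)
    fix t
    show "norm (exp (- x * t) * e t) \<le> norm (exp_decay (2 * x) t + \<bar>e t\<bar>\<^sup>2)"
    proof (cases "t < 0")
      case True
      then show ?thesis using c by (simp add: causal_def)
    next
      case False
      then have "exp_decay (2 * x) t = (exp (- x * t))\<^sup>2"
        by (simp add: exp_decay_def power2_eq_square exp_add[symmetric])
      moreover have "exp (- x * t) * \<bar>e t\<bar> \<le> (exp (- x * t))\<^sup>2 + \<bar>e t\<bar>\<^sup>2"
        using sum_squares_bound[of "exp (- x * t)" "\<bar>e t\<bar>"]
          mult_nonneg_nonneg[of "exp (- x * t)" "\<bar>e t\<bar>"] by (simp del: mult_nonneg_nonneg)
      ultimately show ?thesis
        by (simp add: abs_mult)
    qed
  qed
qed

text \<open>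
  The inequality of Cauchy and Schwarz for \<open>e\<close> and \<open>exp (- a t)\<close> on \<open>t \<ge> 0\<close>. With \<open>I = E a\<close>, it comes
  from expanding \<open>0 \<le> \<parallel>e - c exp (- a t)\<parallel>\<^sup>2\<close> at the optimal value \<open>c = 2 a I\<close>.
\<close>

lemma laplace_le_signal_norm:
  assumes c: "causal e" and e: "L2_signal e" and a: "a > 0"
  shows "2 * a * (cmod (laplace e (of_real a)))\<^sup>2 \<le> (signal_norm e)\<^sup>2"
proof -
  define I where "I = (LINT t|lborel. exp (- a * t) * e t)"
  have "laplace e (of_real a) = of_real I"
    unfolding laplace_causal[OF c] I_def integral_complex_of_real[symmetric]
    by (simp add: exp_of_real[symmetric])
  then have norm_I: "(cmod (laplace e (of_real a)))\<^sup>2 = I\<^sup>2"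
    by simp
  have i1: "integrable lborel (\<lambda>t. \<bar>e t\<bar>\<^sup>2)"
    using e by (simp add: L2_signal_def)
  have i2: "integrable lborel (\<lambda>t. exp (- a * t) * e t)"
    using L2_imp_laplace_convergent[OF c e a] by (simp only: laplace_convergent_causal[OF c])
  have i3: "integrable lborel (exp_decay (2 * a))" "(LINT t|lborel. exp_decay (2 * a) t) = 1 / (2 * a)"
    using a integrable_exp_decay integral_exp_decay by auto
  have sq: "(e t - 2 * a * I * exp_decay a t)\<^sup>2 =
      \<bar>e t\<bar>\<^sup>2 - 4 * a * I * (exp (- a * t) * e t) + 4 * a\<^sup>2 * I\<^sup>2 * exp_decay (2 * a) t" for t
  proof (cases "t < 0")
    case True
    then show ?thesis using c by (simp add: causal_def exp_decay_def)
  next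
    case False
    then have "exp_decay (2 * a) t = (exp (- a * t))\<^sup>2" "exp_decay a t = exp (- a * t)"
      by (simp_all add: exp_decay_def power2_eq_square exp_add[symmetric])
    then show ?thesis
      by (simp add: power2_eq_square algebra_simps)
  qed
  have "0 \<le> (LINT t|lborel. (e t - 2 * a * I * exp_decay a t)\<^sup>2)"
    by simp
  also have "\<dots> = (LINT t|lborel. \<bar>e t\<bar>\<^sup>2) - 4 * a * I * I + 4 * a\<^sup>2 * I\<^sup>2 * (1 / (2 * a))"
    unfolding sq using i1 i2 i3 by (simp add: I_def)
  also have "\<dots> = (LINT t|lborel. \<bar>e t\<bar>\<^sup>2) - 2 * a * I\<^sup>2"
    using a by (simp add: power2_eq_square field_simps)
  finally show ?thesis
    by (simp add: norm_I signal_norm_def)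
qed

text \<open>
  A string stable chain has square-integrable errors, and then the loop equation, which is given far to
  the right only, holds up to the imaginary axis: on \<open>Re s > 0\<close> the left-hand side is analytic and the
  right-hand side is meromorphic.
\<close>

lemma realized_laplace_eq:
  assumes e: "realizes \<sigma> e F" "L2_signal e"
    and F: "F meromorphic_on {s. Re s > 0}" and a: "a > 0" "F analytic_on {of_real a}"
  shows "laplace e (of_real a) = F (of_real a)"
proof (rule meromorphic_identity[where f = "laplace e" and g = F and A = "{s. Re s > 0}" and U = "{s. Re s > max \<sigma> 0}"
      and u = "of_real (max \<sigma> 0 + 1)"])
  let ?H = "{s :: complex. Re s > 0}"
  have H: "open ?H"
    by (rule open_halfspace_Re_gt)
  have c: "causal e" using e by (simp add: realizes_def)
  have hol: "laplace e holomorphic_on ?H"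
    by (rule laplace_holomorphic[OF c L2_imp_laplace_convergent[OF c e(2)]])
  then have an: "laplace e analytic_on ?H"
    using H by (simp add: analytic_on_open)
  then show "laplace e meromorphic_on ?H"
    by (rule analytic_on_imp_meromorphic_on)
  show "laplace e analytic_on {of_real a}"
    using an by (rule analytic_on_subset) (use a in auto)
  show "open {s. Re s > max \<sigma> 0}" by (rule open_halfspace_Re_gt)
  show "of_real (max \<sigma> 0 + 1) \<in> {s. Re s > max \<sigma> 0}" by (auto simp: max_def)
  show "connected ?H"
    by (intro convex_connected convex_halfspace_Re_gt)
qed (use assms in \<open>auto simp: realizes_def open_halfspace_Re_gt\<close>)

lemma exp_bounded_signal:
  assumes m: "g \<in> borel_measurable borel" and b: "\<And>t. \<bar>g t\<bar> \<le> C * exp_decay a t" and a: "a > 0" and C: "C \<ge> 0"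
  shows "L2_signal g" "signal_norm g \<le> C / sqrt (2 * a)"
proof -
  have i: "integrable lborel (\<lambda>t. C\<^sup>2 * exp_decay (2 * a) t)"
    using integrable_exp_decay[of "2 * a"] a by simp
  have le: "\<bar>g t\<bar>\<^sup>2 \<le> C\<^sup>2 * exp_decay (2 * a) t" for t
  proof -
    have "\<bar>g t\<bar>\<^sup>2 \<le> (C * exp_decay a t)\<^sup>2"
      by (intro power_mono b) simp
    also have "\<dots> = C\<^sup>2 * exp_decay (2 * a) t"
      by (simp add: exp_decay_def power2_eq_square exp_add[symmetric])
    finally show ?thesis .
  qed
  have ig: "integrable lborel (\<lambda>t. \<bar>g t\<bar>\<^sup>2)"
    by (rule Bochner_Integration.integrable_bound[OF i]) (use m le in \<open>auto simp: exp_decay_def\<close>)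
  then show "L2_signal g"
    using m by (simp add: L2_signal_def)
  have "(LINT t|lborel. \<bar>g t\<bar>\<^sup>2) \<le> (LINT t|lborel. C\<^sup>2 * exp_decay (2 * a) t)"
    using ig i le by (intro integral_mono) auto
  also have "\<dots> = (C / sqrt (2 * a))\<^sup>2"
    using a integral_exp_decay[of "2 * a"] by (simp add: power_divide)
  finally show "signal_norm g \<le> C / sqrt (2 * a)"
    using a C unfolding signal_norm_def by (intro real_le_lsqrt) auto
qed

section \<open>Smoothed exponentials\<close>

text \<open>
  A filter with a pole at \<open>- b\<close> to the left of \<open>- a\<close> preserves the decay rate \<open>a\<close>, because
  \<open>exp (- b (t - u)) exp (- a u) = exp (- a t) exp (- (b - a) (t - u))\<close> and the last factor has the
  integral \<open>1 / (b - a)\<close>.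
\<close>

lemma conv_exp_decay_bound:
  assumes a: "0 < a" "a < b" and g: "causal g" "\<And>t. \<bar>g t\<bar> \<le> C * exp_decay a t"
  shows "\<bar>conv (exp_decay b) g t\<bar> \<le> C / (b - a) * exp_decay a t"
proof (cases "t < 0")
  case True
  then show ?thesis
    using causal_conv[OF causal_exp_decay g(1)] by (simp add: causal_def exp_decay_def)
next
  case False
  have C: "C \<ge> 0"
    using g(2)[of 0] by (simp add: exp_decay_def)
  have i: "integrable lborel (\<lambda>u. C * exp (- a * t) * exp_decay (b - a) (t - u))"
    using a lborel_integrable_real_affine[OF integrable_exp_decay, of "b - a" "-1" t] by simp
  have "\<bar>conv (exp_decay b) g t\<bar> \<le> (LINT u|lborel. \<bar>exp_decay b (t - u) * g u\<bar>)"
    unfolding conv_def by (rule integral_abs_bound)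
  also have "\<dots> \<le> (LINT u|lborel. C * exp (- a * t) * exp_decay (b - a) (t - u))"
  proof (rule integral_mono'[OF i])
    fix u
    show "\<bar>exp_decay b (t - u) * g u\<bar> \<le> C * exp (- a * t) * exp_decay (b - a) (t - u)"
    proof (cases "u < 0")
      case True
      then show ?thesis using g(1) C by (simp add: causal_def exp_decay_def)
    next
      case False
      have "\<bar>exp_decay b (t - u) * g u\<bar> \<le> exp_decay b (t - u) * (C * exp_decay a u)"
        unfolding abs_mult by (intro mult_mono g(2)) (auto simp: exp_decay_def)
      also have "\<dots> = C * exp (- a * t) * exp_decay (b - a) (t - u)"
        using False by (simp add: exp_decay_def exp_add[symmetric] algebra_simps)
      finally show ?thesis .
    qed
  qed (use C in \<open>auto simp: exp_decay_def\<close>)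
  also have "\<dots> = C * exp (- a * t) * (1 / (b - a))"
    using a integral_exp_decay[of "b - a"] by (simp add: integral_reflect_shift[of "exp_decay (b - a)"])
  finally show ?thesis
    using False by (simp add: exp_decay_def)
qed

text \<open>
  The filtered exponential that will disturb the leader. For \<open>a \<rightarrow> 0\<close> with \<open>M\<close> fixed, the factor
  \<open>(1 / (1 - a)) ^ M\<close> tends to \<open>1\<close>, so that filtering does not increase the norm in the limit.
\<close>

lemma smoothed_exp_decay:
  assumes a: "0 < a" "a < 1" and \<sigma>: "\<sigma> \<ge> 0"
  shows "\<exists>g. realizes \<sigma> g (\<lambda>s. 1 / ((s + of_real a) * (s + 1) ^ M)) \<and>
    (\<forall>t. \<bar>g t\<bar> \<le> (1 / (1 - a)) ^ M * exp_decay a t)"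
proof (induction M)
  case 0
  have "realizes \<sigma> (exp_decay a) (\<lambda>s. 1 / (s + of_real a))"
    using a \<sigma> by (intro realizes_exp_decay) auto
  then show ?case
    by (intro exI[of _ "exp_decay a"]) (auto, simp add: exp_decay_def)
next
  case (Suc M)
  then obtain g where g: "realizes \<sigma> g (\<lambda>s. 1 / ((s + of_real a) * (s + 1) ^ M))"
    and b: "\<And>t. \<bar>g t\<bar> \<le> (1 / (1 - a)) ^ M * exp_decay a t" by blast
  have "realizes \<sigma> (exp_decay 1) (\<lambda>s. 1 / (s + of_real 1))"
    using \<sigma> by (intro realizes_exp_decay) auto
  from realizes_mult[OF this g]
  have "realizes \<sigma> (conv (exp_decay 1) g) (\<lambda>s. 1 / ((s + of_real a) * (s + 1) ^ Suc M))"
    by (rule realizes_cong) (simp add: field_simps)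
  moreover have "\<bar>conv (exp_decay 1) g t\<bar> \<le> (1 / (1 - a)) ^ Suc M * exp_decay a t" for t
    using conv_exp_decay_bound[OF a _ b, of t] g by (simp add: realizes_def power_divide mult_ac)
  ultimately show ?case by blast
qed

text \<open>
  One filter absorbs one derivative: \<open>s / (s + 1) = 1 - 1 / (s + 1)\<close> maps a realizable transform \<open>Y\<close>
  to \<open>Y - 1 / (s + 1) Y\<close>, which is realized by a function again.
\<close>

lemma transfer_function_smoothed:
  assumes "transfer_function F"
  obtains \<sigma> m where "\<And>\<tau>. \<tau> \<ge> \<sigma> \<Longrightarrow> \<tau> \<ge> 0 \<Longrightarrow> \<exists>k. realizes \<tau> k (\<lambda>s. F s / (s + 1) ^ m)"
proof -
  obtain \<sigma> m f where L: "laplace_convergent \<sigma> f" and F: "\<And>s. Re s > \<sigma> \<Longrightarrow> F s = s ^ m * laplace f s"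
    using assms unfolding transfer_function_def by blast
  \<comment> \<open>The Laplace transform ignores negative times, so \<open>f\<close> can be replaced by a causal function.\<close>
  define f' where "f' t = (if t < 0 then 0 else f t)" for t
  have c: "causal f'"
    by (simp add: causal_def f'_def)
  have L': "laplace_convergent \<sigma> f'"
    using L unfolding laplace_convergent_def set_integrable_def
    by (rule Bochner_Integration.integrable_cong[THEN iffD1, rotated -1]) (auto simp: f'_def indicator_def)
  have eq: "laplace f' = laplace f"
    unfolding laplace_def set_lebesgue_integral_def fun_eq_iff
    by (intro allI Bochner_Integration.integral_cong) (auto simp: f'_def indicator_def)
  show ?thesis
  proof (rule that)
    fix \<tau> assume \<tau>: "\<tau> \<ge> \<sigma>" "\<tau> \<ge> 0"
    have f': "realizes \<tau> f' (laplace f)"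
      using c laplace_convergent_mono[OF c L' \<tau>(1)] by (simp add: realizes_def eq)
    have "\<exists>k. realizes \<tau> k (\<lambda>s. (s / (s + 1)) ^ m * laplace f s)" for m
    proof (induction m)
      case 0
      then show ?case using f' by auto
    next
      case (Suc m)
      then obtain k where k: "realizes \<tau> k (\<lambda>s. (s / (s + 1)) ^ m * laplace f s)" by blast
      have "realizes \<tau> (exp_decay 1) (\<lambda>s. 1 / (s + of_real 1))"
        using \<tau> by (intro realizes_exp_decay) auto
      from realizes_diff[OF k realizes_mult[OF this k]]
      have "realizes \<tau> (\<lambda>t. k t - conv (exp_decay 1) k t)
          (\<lambda>s. (s / (s + 1)) ^ Suc m * laplace f s)"
      proof (rule realizes_cong)
        fix s :: complex assume "Re s > \<tau>"
        then have "s + 1 \<noteq> 0"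
          using \<tau> by (auto simp: complex_eq_iff)
        then have "1 - 1 / (s + 1) = s / (s + 1)"
          by (simp add: field_simps)
        then have "s / (s + 1) * Y = Y - 1 / (s + of_real 1) * Y" for Y
          by (metis left_diff_distrib mult_1 of_real_1)
        then show "(s / (s + 1)) ^ m * laplace f s -
            1 / (s + of_real 1) * ((s / (s + 1)) ^ m * laplace f s) =
            (s / (s + 1)) ^ Suc m * laplace f s"
          by (metis power_Suc mult.assoc)
      qed
      then show ?case by blast
    qed
    then obtain k where "realizes \<tau> k (\<lambda>s. (s / (s + 1)) ^ m * laplace f s)" by blast
    then have "realizes \<tau> k (\<lambda>s. F s / (s + 1) ^ m)"
      by (rule realizes_cong) (use F \<tau> in \<open>simp add: power_divide\<close>)
    then show "\<exists>k. realizes \<tau> k (\<lambda>s. F s / (s + 1) ^ m)" by blast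
  qed
qed

section \<open>Low-frequency disturbances of the leader\<close>

text \<open>
  Each of the at most \<open>N\<close> factors \<open>T\<close> uses up \<open>m\<close> filters and the factor \<open>G\<close> uses up \<open>n\<close>, so \<open>N m + n\<close>
  filters suffice for all errors in the chain. That \<open>M\<close> does not depend on \<open>a\<close> is essential: the
  limit \<open>a \<rightarrow> 0\<close> is taken with \<open>M\<close> fixed.
\<close>

lemma chain_response_exists:
  assumes T: "transfer_function T" and G: "transfer_function G"
  obtains \<sigma> M where
    "\<And>a. 0 < a \<Longrightarrow> a < 1 \<Longrightarrow>
       \<exists>g e. realizes \<sigma> g (\<lambda>s. 1 / ((s + of_real a) * (s + 1) ^ M)) \<and>
         (\<forall>t. \<bar>g t\<bar> \<le> (1 / (1 - a)) ^ M * exp_decay a t) \<and>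
         (\<forall>i\<le>N. realizes \<sigma> (e i) (\<lambda>s. T s ^ i * G s * (1 / ((s + of_real a) * (s + 1) ^ M))))"
proof -
  obtain \<sigma>T m where T': "\<And>\<tau>. \<tau> \<ge> \<sigma>T \<Longrightarrow> \<tau> \<ge> 0 \<Longrightarrow> \<exists>k. realizes \<tau> k (\<lambda>s. T s / (s + 1) ^ m)"
    using transfer_function_smoothed[OF T] by blast
  obtain \<sigma>G n where G': "\<And>\<tau>. \<tau> \<ge> \<sigma>G \<Longrightarrow> \<tau> \<ge> 0 \<Longrightarrow> \<exists>k. realizes \<tau> k (\<lambda>s. G s / (s + 1) ^ n)"
    using transfer_function_smoothed[OF G] by blast
  define \<sigma> where "\<sigma> = max 0 (max \<sigma>T \<sigma>G)"
  have s: "\<sigma> \<ge> 0" "\<sigma> \<ge> \<sigma>T" "\<sigma> \<ge> \<sigma>G"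
    by (simp_all add: \<sigma>_def)
  define M where "M = N * m + n"
  obtain k where k: "realizes \<sigma> k (\<lambda>s. T s / (s + 1) ^ m)"
    using T'[of \<sigma>] s by blast
  obtain l where l: "realizes \<sigma> l (\<lambda>s. G s / (s + 1) ^ n)"
    using G'[of \<sigma>] s by blast
  show ?thesis
  proof (rule that[of \<sigma> M])
    fix a :: real assume a: "0 < a" "a < 1"
    have "\<exists>e. realizes \<sigma> e (\<lambda>s. T s ^ i * G s * (1 / ((s + of_real a) * (s + 1) ^ M)))" if i: "i \<le> N" for i
    proof -
      obtain q where q: "realizes \<sigma> q (\<lambda>s. 1 / ((s + of_real a) * (s + 1) ^ ((N - i) * m)))"
        using smoothed_exp_decay[OF a s(1)] by blast
      obtain e where e: "realizes \<sigma> e (\<lambda>s. (T s / (s + 1) ^ m) ^ i *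
          (G s / (s + 1) ^ n * (1 / ((s + of_real a) * (s + 1) ^ ((N - i) * m)))))"
        using realizes_power_mult[OF k realizes_mult[OF l q]] by blast
      have M: "M = i * m + n + (N - i) * m"
        using i by (simp add: M_def add_mult_distrib[symmetric])
      have "realizes \<sigma> e (\<lambda>s. T s ^ i * G s * (1 / ((s + of_real a) * (s + 1) ^ M)))"
        by (rule realizes_cong[OF e])
           (simp add: M power_add power_mult[symmetric] power_divide mult_ac)
      then show ?thesis by blast
    qed
    then obtain e where "\<forall>i\<le>N. realizes \<sigma> (e i) (\<lambda>s. T s ^ i * G s * (1 / ((s + of_real a) * (s + 1) ^ M)))"
      by metis
    then show "\<exists>g e. realizes \<sigma> g (\<lambda>s. 1 / ((s + of_real a) * (s + 1) ^ M)) \<and>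
         (\<forall>t. \<bar>g t\<bar> \<le> (1 / (1 - a)) ^ M * exp_decay a t) \<and>
         (\<forall>i\<le>N. realizes \<sigma> (e i) (\<lambda>s. T s ^ i * G s * (1 / ((s + of_real a) * (s + 1) ^ M))))"
      using smoothed_exp_decay[OF a s(1)] by blast
  qed
qed

lemma loop_near_0:
  assumes K: "K analytic_on {0}" and K0: "K 0 \<noteq> 0"
  shows "isCont (loop_T K h) 0" "isCont (loop_G K h) 0"
    "eventually (\<lambda>s. loop_T K h analytic_on {s} \<and> loop_G K h analytic_on {s}) (nhds 0)"
    "loop_T K h 0 = 1" "loop_G K h 0 = 1 / K 0"
proof -
  have T: "loop_T K h analytic_on {0}" and G: "loop_G K h analytic_on {0}"
    using K K0 unfolding loop_T_def[abs_def] loop_G_def[abs_def]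
    by (auto intro!: analytic_intros)
  then show "isCont (loop_T K h) 0" "isCont (loop_G K h) 0"
    by (auto intro: analytic_at_imp_isCont)
  show "eventually (\<lambda>s. loop_T K h analytic_on {s} \<and> loop_G K h analytic_on {s}) (nhds 0)"
  proof -
    have "loop_T K h analytic_on {0} \<and> loop_G K h analytic_on {0}"
      using T G by blast
    then obtain A B where AB: "open A" "0 \<in> A" "loop_T K h holomorphic_on A"
        "open B" "0 \<in> B" "loop_G K h holomorphic_on B"
      unfolding analytic_at by blast
    then have "eventually (\<lambda>s. s \<in> A \<inter> B) (nhds 0)"
      by (intro eventually_nhds_in_open) auto
    then show ?thesis
      by eventually_elim (use AB holomorphic_on_imp_analytic_at in blast)
  qed
  show "loop_T K h 0 = 1" "loop_G K h 0 = 1 / K 0"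
    using K0 by (simp_all add: loop_T_def loop_G_def)
qed

text \<open>
  For each \<open>i\<close> the lower bound on \<open>\<parallel>e\<^sub>i\<parallel>\<close> obtained at the point \<open>a\<close> tends to \<open>\<mu> \<bar>1 / K 0\<bar>\<close> as \<open>a \<rightarrow> 0\<close>.
  Finitely many such limits can be met with one \<open>a\<close>, so a single disturbance of size \<open>\<mu>\<close> makes all \<open>N\<close>
  errors at least as large as \<open>C\<close>. The construction yields \<open>e\<^sub>i\<close> with a Laplace transform on some half plane only; that
  \<open>e\<^sub>i\<close> is square-integrable is left as a premise of the bound, to be supplied by string stability.
\<close>

lemma persistent_leader_disturbance:
  assumes K: "K analytic_on {0}" "K 0 \<noteq> 0" and stab: "stabilizing K h"
    and N1: "N \<ge> 1" and \<mu>: "\<mu> > 0" and C: "C < \<mu> * cmod (1 / K 0)"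
  obtains d e where "closed_loop K h N d e" "\<And>i. L2_signal (d i)"
    "L2_set (\<lambda>i. signal_norm (d i)) {0..N} \<le> \<mu>"
    "\<And>i. i \<in> {1..N} \<Longrightarrow> L2_signal (e i) \<Longrightarrow> C \<le> signal_norm (e i)"
proof -
  define T where "T = loop_T K h"
  define G where "G = loop_G K h"
  note near = loop_near_0[OF K, of h, folded T_def G_def]
  have tf: "transfer_function T" "transfer_function G"
    using stab by (simp_all add: stabilizing_def T_def G_def)
  have mero: "T meromorphic_on {s. Re s > 0}" "G meromorphic_on {s. Re s > 0}"
    using tf by (auto simp: transfer_function_def elim: meromorphic_on_subset)
  obtain \<sigma> M where resp: "\<And>a. 0 < a \<Longrightarrow> a < 1 \<Longrightarrow>
       \<exists>g e. realizes \<sigma> g (\<lambda>s. 1 / ((s + of_real a) * (s + 1) ^ M)) \<and>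
         (\<forall>t. \<bar>g t\<bar> \<le> (1 / (1 - a)) ^ M * exp_decay a t) \<and>
         (\<forall>i\<le>N. realizes \<sigma> (e i) (\<lambda>s. T s ^ i * G s * (1 / ((s + of_real a) * (s + 1) ^ M))))"
    using chain_response_exists[OF tf] by blast

  \<comment> \<open>The lower bound for the norm of \<open>e (i + 1)\<close>, the amplitude of \<open>d 0\<close> being chosen below.\<close>
  define \<rho> where "\<rho> i a = \<mu> * (((1 - a) / (1 + a)) ^ M * (cmod (T (of_real a)) ^ i * cmod (G (of_real a))))"
    for i :: nat and a :: real
  have "eventually (\<lambda>a. \<rho> i a > C) (at_right 0)" for i
  proof -
    have "isCont complex_of_real 0"
      by (intro continuous_intros)
    then have "isCont (\<lambda>a. T (complex_of_real a)) 0" "isCont (\<lambda>a. G (complex_of_real a)) 0"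
      using near(1,2) isCont_o2[of 0 complex_of_real] by force+
    then have "isCont (\<rho> i) 0"
      unfolding \<rho>_def by (intro continuous_mult continuous_power continuous_norm
          continuous_divide continuous_diff continuous_add continuous_const continuous_ident) auto
    then have "(\<rho> i \<longlongrightarrow> \<rho> i 0) (at_right 0)"
      by (simp add: isCont_def filterlim_at_split)
    moreover have "\<rho> i 0 > C"
      using C by (simp add: \<rho>_def near(4,5))
    ultimately show ?thesis
      by (rule order_tendstoD)
  qed
  then have "eventually (\<lambda>a. \<forall>i\<in>{..N}. \<rho> i a > C) (at_right 0)"
    by (intro eventually_ball_finite) auto
  moreover have "eventually (\<lambda>a. T analytic_on {complex_of_real a} \<and> G analytic_on {complex_of_real a}) (at_right 0)"
  proof -
    have "filterlim complex_of_real (nhds (of_real 0)) (at_right 0)"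
      by (intro tendsto_of_real tendsto_ident_at)
    then show ?thesis
      using eventually_compose_filterlim[of _ "nhds 0"] near(3) by force
  qed
  moreover have "eventually (\<lambda>a::real. 0 < a \<and> a < 1) (at_right 0)"
    unfolding eventually_at_right_field by (intro exI[of _ 1]) auto
  ultimately have "eventually (\<lambda>a. (\<forall>i\<in>{..N}. \<rho> i a > C) \<and>
      (T analytic_on {complex_of_real a} \<and> G analytic_on {complex_of_real a}) \<and> 0 < a \<and> a < 1) (at_right 0)"
    by eventually_elim auto
  from eventually_happens'[OF trivial_limit_at_right_real this]
  obtain a where \<rho>: "\<And>i. i \<le> N \<Longrightarrow> \<rho> i a > C" and a: "0 < a" "a < 1"
    and an: "T analytic_on {of_real a}" "G analytic_on {of_real a}"
    by (metis atMost_iff)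
  obtain g r where g: "realizes \<sigma> g (\<lambda>s. 1 / ((s + of_real a) * (s + 1) ^ M))"
    and g_bound: "\<And>t. \<bar>g t\<bar> \<le> (1 / (1 - a)) ^ M * exp_decay a t"
    and r: "\<And>i. i \<le> N \<Longrightarrow> realizes \<sigma> (r i) (\<lambda>s. T s ^ i * G s * (1 / ((s + of_real a) * (s + 1) ^ M)))"
    using resp[OF a] by blast

  \<comment> \<open>The factor \<open>sqrt (2 * a)\<close> normalizes \<open>exp_decay a\<close>, whose norm is \<open>1 / sqrt (2 * a)\<close>, and the
    power of \<open>1 - a\<close> compensates the bound on \<open>g\<close>.\<close>
  define amp where "amp = \<mu> * sqrt (2 * a) * (1 - a) ^ M"
  have amp_nonneg: "amp \<ge> 0" using \<mu> a by (simp add: amp_def)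
  define d where "d i = (if i = 0 then (\<lambda>t. amp * g t) else (\<lambda>t. 0))" for i :: nat
  define e where "e i = (\<lambda>t. amp * r (i - 1) t)" for i :: nat
  define D where "D s = of_real amp * (1 / ((s + of_real a) * (s + 1) ^ M))" for s :: complex
  have d0: "realizes \<sigma> (d 0) D"
    using realizes_scale[OF g, of amp] by (simp add: d_def D_def[abs_def])
  have di: "realizes \<sigma> (d i) (\<lambda>s. if i = 0 then D s else 0)" for i
    using d0 realizes_zero by (simp add: d_def)
  have ei: "realizes \<sigma> (e i) (\<lambda>s. T s ^ (i - 1) * G s * D s)" if "i \<in> {1..N}" for i
    unfolding e_def
    by (rule realizes_cong[OF realizes_scale[OF r]]) (use that in \<open>auto simp: D_def\<close>)
  have loop: "closed_loop K h N d e"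
    unfolding closed_loop_def T_def[symmetric] G_def[symmetric]
  proof (intro conjI ballI exI[of _ \<sigma>] allI impI)
    fix s :: complex assume s: "Re s > \<sigma>"
    have ds: "laplace (d i) s = (if i = 0 then D s else 0)" for i
      using di[of i] s by (simp add: realizes_def)
    have es: "laplace (e i) s = T s ^ (i - 1) * G s * D s" if "i \<in> {1..N}" for i
      using ei[OF that] s by (simp add: realizes_def)
    show "laplace (e 1) s = G s * (laplace (d 0) s - (1 + of_real h * s) * laplace (d 1) s)"
      using N1 by (simp add: ds es)
    fix i assume i: "i \<in> {2..N}"
    have "T s ^ (i - 1) = T s * T s ^ (i - 1 - 1)"
      using i by (intro power_eq_if[THEN trans]) auto
    moreover have "i \<in> {1..N}" "i - 1 \<in> {1..N}" "i \<noteq> 0" "i - 1 \<noteq> 0" using i by auto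
    ultimately show "laplace (e i) s = T s * laplace (e (i - 1)) s +
          G s * (laplace (d (i - 1)) s - (1 + of_real h * s) * laplace (d i) s)"
      by (simp only: ds es if_False) (simp add: mult_ac)
  qed (use di ei in \<open>auto simp: realizes_def\<close>)

  have g_meas: "g \<in> borel_measurable borel"
    using g laplace_convergent_imp_measurable by (auto simp: realizes_def)
  have d0_bound: "\<bar>d 0 t\<bar> \<le> \<mu> * sqrt (2 * a) * exp_decay a t" for t
  proof -
    have "\<bar>d 0 t\<bar> \<le> amp * ((1 / (1 - a)) ^ M * exp_decay a t)"
      using amp_nonneg g_bound[of t] by (simp add: d_def abs_mult mult_left_mono)
    also have "\<dots> = \<mu> * sqrt (2 * a) * exp_decay a t"
      using a by (simp add: amp_def power_divide)
    finally show ?thesis .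
  qed
  have "L2_signal (d 0)" "signal_norm (d 0) \<le> \<mu> * sqrt (2 * a) / sqrt (2 * a)"
    using exp_bounded_signal[OF _ d0_bound a(1)] g_meas \<mu> a by (auto simp: d_def)
  then have d0': "L2_signal (d 0)" "signal_norm (d 0) \<le> \<mu>"
    using a by simp_all
  have zero: "signal_norm (d i) = 0" "L2_signal (d i)" if "i \<noteq> 0" for i
    using that by (auto simp: d_def signal_norm_def L2_signal_def)
  have "L2_set (\<lambda>i. signal_norm (d i)) {0..N} = sqrt (\<Sum>i\<in>{0}. (signal_norm (d i))\<^sup>2)"
    unfolding L2_set_def by (intro arg_cong[where f = sqrt] sum.mono_neutral_right) (auto simp: zero)
  also have "\<dots> = signal_norm (d 0)"
    by (simp add: signal_norm_def)
  also have "\<dots> \<le> \<mu>"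
    by fact
  finally have small: "L2_set (\<lambda>i. signal_norm (d i)) {0..N} \<le> \<mu>" .
  have dL2: "L2_signal (d i)" for i
    using d0' zero by (cases "i = 0") auto
  have big: "C \<le> signal_norm (e i)" if i: "i \<in> {1..N}" and eL2: "L2_signal (e i)" for i
  proof -
    define P where "P s = T s ^ (i - 1) * G s * D s" for s
    have nz: "s + of_real a \<noteq> 0" "s + 1 \<noteq> 0" if "Re s > 0" for s
      using that a by (auto simp: complex_eq_iff)
    have D: "D analytic_on {s. Re s > 0}"
      unfolding D_def using nz by (auto intro!: analytic_intros)
    have "laplace (e i) (of_real a) = P (of_real a)"
    proof (rule realized_laplace_eq)
      show "realizes \<sigma> (e i) P"
        using ei[OF i] by (simp add: P_def[abs_def])
      show "P meromorphic_on {s. Re s > 0}"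
        unfolding P_def[abs_def] using mero analytic_on_imp_meromorphic_on[OF D]
        by (intro meromorphic_intros)
      have "D analytic_on {of_real a}"
        using D by (rule analytic_on_subset) (use a in auto)
      then show "P analytic_on {of_real a}"
        unfolding P_def[abs_def] using an by (intro analytic_intros)
    qed (use eL2 a in auto)
    moreover have "\<rho> (i - 1) a = sqrt (2 * a) * cmod (P (of_real a))"
    proof -
      have "of_real a + of_real a = complex_of_real (2 * a)" "of_real a + 1 = complex_of_real (1 + a)"
        by simp_all
      then have "D (of_real a) = of_real (amp * (1 / (2 * a * (1 + a) ^ M)))"
        unfolding D_def by (simp only: of_real_mult of_real_divide of_real_power of_real_1)
      then have D1: "cmod (D (of_real a)) = amp * (1 / (2 * a * (1 + a) ^ M))"
        using amp_nonneg a by (simp only: norm_of_real) simp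
      have D2: "sqrt (2 * a) * (amp * (1 / (2 * a * (1 + a) ^ M))) = \<mu> * ((1 - a) / (1 + a)) ^ M"
      proof -
        have "sqrt (2 * a) * amp = 2 * a * \<mu> * (1 - a) ^ M"
          using a by (simp add: amp_def mult.assoc[symmetric] mult.commute[of _ \<mu>])
        then show ?thesis using a by (simp add: power_divide field_simps)
      qed
      have "\<rho> (i - 1) a = (\<mu> * ((1 - a) / (1 + a)) ^ M) *
          (cmod (T (of_real a)) ^ (i - 1) * cmod (G (of_real a)))"
        by (simp only: \<rho>_def mult.assoc)
      also have "\<dots> = sqrt (2 * a) * cmod (D (of_real a)) *
          (cmod (T (of_real a)) ^ (i - 1) * cmod (G (of_real a)))"
        by (simp only: D1 D2)
      finally show ?thesis
        by (simp add: P_def norm_mult norm_power mult_ac)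
    qed
    ultimately have "(\<rho> (i - 1) a)\<^sup>2 = 2 * a * (cmod (laplace (e i) (of_real a)))\<^sup>2"
      using a by (simp add: power_mult_distrib)
    also have "\<dots> \<le> (signal_norm (e i))\<^sup>2"
      by (rule laplace_le_signal_norm) (use ei[OF i] eL2 a in \<open>auto simp: realizes_def\<close>)
    finally have "\<rho> (i - 1) a \<le> signal_norm (e i)"
      by (rule power2_le_imp_le) (simp add: signal_norm_def)
    moreover have "i - 1 \<le> N"
      using i by auto
    ultimately show ?thesis
      using \<rho> by fastforce
  qed
  show ?thesis
    using that[OF loop dL2 small big] .
qed

section \<open>No string stability\<close>

theorem theorem2:
  "\<not> (\<exists>(K :: complex \<Rightarrow> complex) (h :: real).
        h \<ge> 0 \<and> transfer_function K \<and> K analytic_on {0} \<and> K 0 \<noteq> 0 \<and>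
        stabilizing K h \<and> L2_l2_string_stable K h)"
proof (rule notI, elim exE conjE)
  fix K :: "complex \<Rightarrow> complex" and h :: real
  assume K: "K analytic_on {0}" "K 0 \<noteq> 0" and stab: "stabilizing K h"
    and stable: "L2_l2_string_stable K h"
  obtain \<delta> where \<delta>: "\<delta> > 0" and bound: "\<And>N d e. N \<ge> 1 \<Longrightarrow> (\<forall>i\<in>{0..N}. L2_signal (d i)) \<Longrightarrow>
      closed_loop K h N d e \<Longrightarrow> L2_set (\<lambda>i. signal_norm (d i)) {0..N} < \<delta> \<Longrightarrow>
      (\<forall>i\<in>{1..N}. L2_signal (e i)) \<and> L2_set (\<lambda>i. signal_norm (e i)) {1..N} < 1"
    using stable[unfolded L2_l2_string_stable_def, rule_format, OF zero_less_one] by blast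
  \<comment> \<open>\<open>C\<close> is half of the limiting size of each error, and \<open>N\<close> is so large that \<open>N\<close> errors of norm \<open>C\<close>
    reach the total norm \<open>1\<close>.\<close>
  define \<mu> where "\<mu> = \<delta> / 2"
  define C where "C = \<mu> * cmod (1 / K 0) / 2"
  have \<mu>: "\<mu> > 0" and C: "C > 0"
    using \<delta> K by (simp_all add: \<mu>_def C_def)
  obtain N :: nat where N: "1 / C\<^sup>2 < of_nat N"
    using reals_Archimedean2 by blast
  have "of_nat N > (0::real)"
    using N C by (smt (verit) zero_less_divide_1_iff zero_less_power)
  then have N1: "N \<ge> 1" by simp
  have below: "C < \<mu> * cmod (1 / K 0)"
    using \<mu> K by (simp add: C_def field_simps)
  obtain d e where loop: "closed_loop K h N d e" and d: "\<And>i. L2_signal (d i)"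
    and small: "L2_set (\<lambda>i. signal_norm (d i)) {0..N} \<le> \<mu>"
    and big: "\<And>i. i \<in> {1..N} \<Longrightarrow> L2_signal (e i) \<Longrightarrow> C \<le> signal_norm (e i)"
    using persistent_leader_disturbance[OF K stab N1 \<mu> below] by blast
  have "\<mu> < \<delta>"
    using \<delta> by (simp add: \<mu>_def)
  then have eL2: "\<And>i. i \<in> {1..N} \<Longrightarrow> L2_signal (e i)"
    and e_small: "L2_set (\<lambda>i. signal_norm (e i)) {1..N} < 1"
    using bound[OF N1 _ loop] d small by auto
  have "1 \<le> of_nat N * C\<^sup>2"
    using N C by (simp add: field_simps)
  also have "\<dots> = (\<Sum>i\<in>{1..N}. C\<^sup>2)" by simp
  also have "\<dots> \<le> (\<Sum>i\<in>{1..N}. (signal_norm (e i))\<^sup>2)"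
    using big eL2 C by (intro sum_mono power_mono) auto
  finally have "1 \<le> L2_set (\<lambda>i. signal_norm (e i)) {1..N}"
    unfolding L2_set_def by simp
  with e_small show False by simp
qed

end
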